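(* Let $(S,\cdot)$ be a finite block-group all of whose subgroups are solvable. Then there exist positive integers $q$ and $r$ such that $(S,\cdot)$ satisfies the identities $\mathbf v_{n,q}^{(r)}=(\mathbf v_{n,q}^{(r)})^2$ for all $n\ge2$.
   Context: A block-group is a semigroup satisfying, for all elements $e,f$, the two implications: if $ef=e^2=e$ and $fe=f^2=f$, then $e=f$; and if $ef=f^2=f$ and $fe=e^2=e$, then $e=f$. A subgroup of a semigroup is a subsemigroup that is a group (its identity element need not be an identity element of the whole semigroup). The words $\mathbf v_{n,m}^{(h)}$: for $i,h\ge1$ let $X_i^{(h)}:=\{x_{i_1i_2\cdots i_h}\mid i_1,\dots,i_h\in\{1,\dots,i\}\}$ be a set of variables. For $n,m\ge1$, the word $\mathbf v_{n,m}^{(h)}$ over $X_{2n}^{(h)}$ is defined by induction on $h\ge1$: $$\mathbf v_{n,m}^{(1)}:=x_1x_2\cdots x_{2n}\,\bigl(x_nx_{n-1}\cdots x_1\cdot x_{n+1}x_{n+2}\cdots x_{2n}\bigr)^{2m-1},$$ and for $h>1$, $$\mathbf v_{n,m}^{(h)}:=\mathbf v_{n,m,1}^{(h-1)}\cdots\mathbf v_{n,m,2n}^{(h-1)}\bigl(\mathbf v_{n,m,n}^{(h-1)}\cdots\mathbf v_{n,m,1}^{(h-1)}\cdot \mathbf v_{n,m,n+1}^{(h-1)}\cdots\mathbf v_{n,m,2n}^{(h-1)}\bigr)^{2m-1},$$ where $\mathbf v_{n,m,j}^{(h-1)}$ is obtained from $\mathbf v_{n,m}^{(h-1)}$ by replacing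 each variable $x_{i_1\dots i_{h-1}}$ by $x_{i_1\dots i_{h-1}j}$. *)

theory Defs
  imports "HOL-Algebra.Solvable_Groups"
begin

locale block_group = semigroup f
  for f :: "'a \<Rightarrow> 'a \<Rightarrow> 'a" (infixl \<open>\<cdot>\<close> 70) +
  assumes left_block: "x \<cdot> y = x \<cdot> x \<Longrightarrow> x \<cdot> x = x \<Longrightarrow> y \<cdot> x = y \<cdot> y \<Longrightarrow> y \<cdot> y = y \<Longrightarrow> x = y"
    and right_block: "x \<cdot> y = y \<cdot> y \<Longrightarrow> y \<cdot> y = y \<Longrightarrow> y \<cdot> x = x \<cdot> x \<Longrightarrow> x \<cdot> x = x \<Longrightarrow> x = y"

text \<open>A set \<open>H\<close> with a distinguished element \<open>e\<close> of a semigroup, viewed as a HOL-Algebra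
  structure. Subgroups of the semigroup are the \<open>H\<close> for which this is a group for some \<open>e\<close>;
  closure of \<open>H\<close> under the operation is part of being a group, and \<open>e\<close> need not be neutral
  outside \<open>H\<close>.\<close>

definition restricted :: "('a \<Rightarrow> 'a \<Rightarrow> 'a) \<Rightarrow> 'a set \<Rightarrow> 'a \<Rightarrow> 'a monoid" where
  "restricted f H e = \<lparr>carrier = H, mult = f, one = e\<rparr>"

definition all_subgroups_solvable :: "('a \<Rightarrow> 'a \<Rightarrow> 'a) \<Rightarrow> bool" where
  "all_subgroups_solvable f \<longleftrightarrow>
     (\<forall>H e. group (restricted f H e) \<longrightarrow> solvable (restricted f H e))"

text \<open>Semigroup words are nonempty lists of variables; the empty list has no value.\<close>

fun word_value :: "('a \<Rightarrow> 'a \<Rightarrow> 'a) \<Rightarrow> ('v \<Rightarrow> 'a) \<Rightarrow> 'v list \<Rightarrow> 'a" where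
  "word_value f \<phi> [] = undefined"
| "word_value f \<phi> [x] = \<phi> x"
| "word_value f \<phi> (x # y # w) = f (\<phi> x) (word_value f \<phi> (y # w))"

definition satisfies_identity :: "('a \<Rightarrow> 'a \<Rightarrow> 'a) \<Rightarrow> 'v list \<Rightarrow> 'v list \<Rightarrow> bool" where
  "satisfies_identity f u w \<longleftrightarrow> (\<forall>\<phi>. word_value f \<phi> u = word_value f \<phi> w)"

definition word_power :: "'v list \<Rightarrow> nat \<Rightarrow> 'v list" where
  "word_power w k = concat (replicate k w)"

text \<open>The word
  \<open>w\<^sub>1 \<cdots> w\<^sub>2\<^sub>n (w\<^sub>n \<cdots> w\<^sub>1 \<cdot> w\<^sub>n\<^sub>+\<^sub>1 \<cdots> w\<^sub>2\<^sub>n)\<close> with the bracket raised to the power \<open>2m - 1\<close>.\<close>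

definition v_pattern :: "nat \<Rightarrow> nat \<Rightarrow> (nat \<Rightarrow> 'v list) \<Rightarrow> 'v list" where
  "v_pattern n m w =
     concat (map w [1..<2 * n + 1]) @
     word_power (concat (map w (rev [1..<n + 1])) @ concat (map w [n + 1..<2 * n + 1])) (2 * m - 1)"

text \<open>The variable \<open>x\<close> with indices \<open>i\<^sub>1, \<dots>, i\<^sub>h\<close> is encoded as the list \<open>[i\<^sub>1, \<dots>, i\<^sub>h]\<close>.
  The words are defined for \<open>h \<ge> 1\<close> only; the value at \<open>h = 0\<close> is a dummy.\<close>

fun v_word :: "nat \<Rightarrow> nat \<Rightarrow> nat \<Rightarrow> nat list list" where
  "v_word n m 0 = []"
| "v_word n m (Suc 0) = v_pattern n m (\<lambda>j. [[j]])"
| "v_word n m (Suc (Suc h)) =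
     v_pattern n m (\<lambda>j. map (\<lambda>i. i @ [j]) (v_word n m (Suc h)))"

end

theory Submission
  imports Defs
begin

text \<open>Let \<open>V\<^sub>h\<close> be the set of values of the words of height \<open>h\<close>. These sets decrease, so they
  stabilise at some \<open>V\<close>, and it suffices that \<open>V\<close> consists of idempotents. Suppose not, and take a
  non-idempotent \<open>v\<close> in \<open>V\<close> with maximal J-class; write \<open>v\<close> as a value of the pattern at
  elements of \<open>V\<close>. In a block-group, every element acts on the idempotents by a partial injection:
  idempotents act as partial identities, and an element of the J-class in question acts with a
  one-point domain. Reading off the palindromic shape of the pattern, \<open>v\<close> fixes a point \<open>e\<close>, that
  is, \<open>v\<close> lies in the maximal subgroup at \<open>e\<close>. The same then holds for all letters outside the
  idempotents, so \<open>v\<close> is a value of the pattern at elements of that subgroup, where the pattern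
  lies in the derived subgroup. Iterating, solvability forces \<open>v = e\<close>.\<close>

section \<open>Products of lists in a group\<close>

context group
begin

lemma foldr_mult_closed:
  assumes "subgroup H G" "set us \<subseteq> H"
  shows "foldr (\<otimes>) us \<one> \<in> H"
  using assms(2)
  by (induction us) (auto intro: subgroup.m_closed[OF assms(1)] subgroup.one_closed[OF assms(1)])

lemma foldr_mult_append:
  assumes "set us \<subseteq> carrier G" "set vs \<subseteq> carrier G"
  shows "foldr (\<otimes>) (us @ vs) \<one> = foldr (\<otimes>) us \<one> \<otimes> foldr (\<otimes>) vs \<one>"
  using assms(1)
proof (induction us)
  case Nil
  then show ?case
    using foldr_mult_closed[OF subgroup_self assms(2)] by simp
next
  case (Cons u us)
  then show ?case
    using foldr_mult_closed[OF subgroup_self assms(2)] foldr_mult_closed[OF subgroup_self, of us]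
    by (simp add: m_assoc)
qed

text \<open>Factors commute modulo the derived subgroup: peeling off \<open>u\<close> costs only its
  commutator with the rest of the product.\<close>

lemma foldr_mult_rev_derived:
  assumes H: "subgroup H G" and "set us \<subseteq> H"
  shows "foldr (\<otimes>) us \<one> \<otimes> inv foldr (\<otimes>) (rev us) \<one> \<in> derived G H"
  using assms(2)
proof (induction us)
  case Nil
  then show ?case
    using subgroup.one_closed[OF derived_is_subgroup[OF subgroup.subset[OF H]]] by simp
next
  case (Cons u us)
  let ?p = "foldr (\<otimes>) us \<one>" and ?r = "foldr (\<otimes>) (rev us) \<one>"
  have HG: "H \<subseteq> carrier G"
    by (rule subgroup.subset[OF H])
  have uH: "u \<in> H" and pH: "?p \<in> H" and rH: "?r \<in> H"
    using Cons.prems foldr_mult_closed[OF H, of us] foldr_mult_closed[OF H, of "rev us"] by auto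
  then have [simp]: "u \<in> carrier G" "?p \<in> carrier G" "?r \<in> carrier G"
    using HG by auto
  have "foldr (\<otimes>) (rev us @ [u]) \<one> = ?r \<otimes> u"
    using foldr_mult_append[of "rev us" "[u]"] Cons.prems HG by auto
  then have "foldr (\<otimes>) (u # us) \<one> \<otimes> inv foldr (\<otimes>) (rev (u # us)) \<one>
      = u \<otimes> ?p \<otimes> inv (?r \<otimes> u)"
    by simp
  also have "\<dots> = (u \<otimes> ?p \<otimes> inv u \<otimes> inv ?p) \<otimes> (?p \<otimes> inv ?r)"
    by (simp add: m_assoc inv_mult_group) (simp add: m_assoc[symmetric])
  also have "\<dots> \<in> derived G H"
  proof (rule subgroup.m_closed[OF derived_is_subgroup[OF HG]])
    show "u \<otimes> ?p \<otimes> inv u \<otimes> inv ?p \<in> derived G H"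
      unfolding derived_def using uH pH by (blast intro: generate.incl)
    show "?p \<otimes> inv ?r \<in> derived G H"
      using Cons by simp
  qed
  finally show ?case .
qed

end

section \<open>Finite block-groups\<close>

locale finite_block_group = block_group f
  for f :: "'a::finite \<Rightarrow> 'a \<Rightarrow> 'a" (infixl \<open>\<cdot>\<close> 70)
begin

section \<open>Products of nonempty lists\<close>

definition val :: "'a list \<Rightarrow> 'a" where
  "val = word_value f (\<lambda>x. x)"

definition pow :: "'a \<Rightarrow> nat \<Rightarrow> 'a" where
  "pow x k = val (replicate k x)"

lemma val_single [simp]: "val [x] = x"
  by (simp add: val_def)

lemma val_Cons: "ws \<noteq> [] \<Longrightarrow> val (w # ws) = w \<cdot> val ws"
  by (cases ws) (auto simp: val_def)

lemma val_append: "us \<noteq> [] \<Longrightarrow> vs \<noteq> [] \<Longrightarrow> val (us @ vs) = val us \<cdot> val vs"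
proof (induction us)
  case (Cons u us)
  then show ?case
    by (cases "us = []") (auto simp: val_Cons assoc)
qed simp

lemma word_value_eq_val_map: "w \<noteq> [] \<Longrightarrow> word_value f \<phi> w = val (map \<phi> w)"
proof (induction w)
  case (Cons x w)
  then show ?case
    by (cases w) (auto simp: val_def)
qed simp

lemma val_concat:
  assumes "wss \<noteq> []" "[] \<notin> set wss"
  shows "val (concat wss) = val (map val wss)"
  using assms
proof (induction wss)
  case (Cons ws wss)
  have "concat wss \<noteq> []" if "wss \<noteq> []"
    using that Cons.prems by (cases wss) auto
  then show ?case
    using Cons by (cases "wss = []") (auto simp: val_Cons val_append simp del: concat_eq_Nil_conv)
qed simp

lemma val_commute:
  assumes "ws \<noteq> []" "\<And>w. w \<in> set ws \<Longrightarrow> e \<cdot> w = w \<cdot> e"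
  shows "e \<cdot> val ws = val ws \<cdot> e"
  using assms
proof (induction ws)
  case (Cons w ws)
  show ?case
  proof (cases "ws = []")
    case True
    then show ?thesis
      using Cons.prems(2)[of w] by simp
  next
    case False
    have "e \<cdot> val ws = val ws \<cdot> e"
      by (rule Cons.IH[OF False Cons.prems(2)]) simp
    moreover have "e \<cdot> w = w \<cdot> e"
      by (rule Cons.prems(2)) simp
    ultimately have "e \<cdot> (w \<cdot> val ws) = w \<cdot> val ws \<cdot> e"
      by (metis assoc)
    then show ?thesis
      using False by (simp add: val_Cons)
  qed
qed simp

lemma val_map_commuting:
  assumes "ws \<noteq> []" and e: "e \<cdot> e = e" and "\<And>w. w \<in> set ws \<Longrightarrow> e \<cdot> w = w \<cdot> e"
  shows "val (map (\<lambda>w. w \<cdot> e) ws) = val ws \<cdot> e"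
  using assms(1,3)
proof (induction ws)
  case (Cons w ws)
  show ?case
  proof (cases "ws = []")
    case True
    then show ?thesis by simp
  next
    case False
    have "e \<cdot> (val ws \<cdot> e) = (e \<cdot> val ws) \<cdot> e"
      by (simp only: assoc)
    also have "e \<cdot> val ws = val ws \<cdot> e"
      by (rule val_commute[OF False Cons.prems(2)]) simp
    also have "val ws \<cdot> e \<cdot> e = val ws \<cdot> e"
      by (simp only: assoc e)
    finally have *: "w \<cdot> e \<cdot> (val ws \<cdot> e) = w \<cdot> val ws \<cdot> e"
      by (simp only: assoc)
    have IH: "val (map (\<lambda>w. w \<cdot> e) ws) = val ws \<cdot> e"
      by (rule Cons.IH[OF False Cons.prems(2)]) simp
    have "val (map (\<lambda>w. w \<cdot> e) (w # ws)) = w \<cdot> e \<cdot> (val ws \<cdot> e)"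
      using False by (simp add: val_Cons IH)
    also have "\<dots> = val (w # ws) \<cdot> e"
      unfolding * using False by (simp add: val_Cons)
    finally show ?thesis .
  qed
qed simp

section \<open>Powers and idempotent powers\<close>

lemma pow_Suc0 [simp]: "pow x (Suc 0) = x"
  by (simp add: pow_def)

lemma pow_add: "0 < i \<Longrightarrow> 0 < j \<Longrightarrow> pow x (i + j) = pow x i \<cdot> pow x j"
  by (simp add: pow_def replicate_add val_append)

lemma pow_Suc: "0 < k \<Longrightarrow> pow x (Suc k) = x \<cdot> pow x k"
  using pow_add[of 1 k x] by simp

lemma pow_Suc2: "0 < k \<Longrightarrow> pow x (Suc k) = pow x k \<cdot> x"
  using pow_add[of k 1 x] by simp

lemma pow_idem: "0 < k \<Longrightarrow> x \<cdot> x = x \<Longrightarrow> pow x k = x"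
  by (induction k rule: nat_induct_non_zero) (simp_all add: pow_Suc)

lemma pow_mult: "0 < j \<Longrightarrow> 0 < k \<Longrightarrow> pow x (k * j) = pow (pow x k) j"
  by (induction j rule: nat_induct_non_zero) (simp_all add: pow_Suc pow_add)

lemma pow_mult_commuting:
  "0 < k \<Longrightarrow> e \<cdot> e = e \<Longrightarrow> e \<cdot> x = x \<cdot> e \<Longrightarrow> pow (x \<cdot> e) k = pow x k \<cdot> e"
  using val_map_commuting[of "replicate k x" e] by (simp add: pow_def map_replicate)

text \<open>Pigeonhole makes the powers periodic from some index \<open>i\<close> on, with period
  \<open>p\<close>. The exponent \<open>i * p\<close> is at least \<open>i\<close> and a multiple of
  \<open>p\<close>, so doubling it changes nothing.\<close>

lemma ex_idem_pow: "\<exists>k>0. pow x k \<cdot> pow x k = pow x k"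
proof -
  have "\<not> inj_on (pow x) {0<..}"
    using finite_imageD[of "pow x" "{0<..}"] infinite_Ioi[of "0::nat"] by auto
  then obtain i p where ip: "0 < i" "0 < p" "pow x (i + p) = pow x i"
    unfolding inj_on_def
    by (metis greaterThan_iff less_imp_add_positive linorder_neqE_nat)
  have period: "pow x (k + j * p) = pow x k" if "i \<le> k" for k j
  proof (induction j)
    case (Suc j)
    have eq: "pow x (l + p) = pow x l" if "i \<le> l" for l
    proof (cases "l = i")
      case False
      then have "pow x (l + p) = pow x (i + p) \<cdot> pow x (l - i)"
        using that ip pow_add[of "i + p" "l - i" x] by (simp add: add.commute)
      also have "\<dots> = pow x l"
        using that False ip pow_add[of i "l - i" x] by (simp add: add.commute)
      finally show ?thesis .
    qed (use ip in simp)
    have "k + Suc j * p = (k + j * p) + p"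
      by simp
    then show ?case
      using eq[of "k + j * p"] Suc that by (metis trans_le_add1)
  qed simp
  have "pow x (i * p) \<cdot> pow x (i * p) = pow x (i * p)"
    using period[of "i * p" i] pow_add[of "i * p" "i * p" x] ip by simp
  then show ?thesis
    using ip by (metis nat_0_less_mult_iff)
qed

lemma ex_uniform_idem_pow: "\<exists>N\<ge>2. \<forall>x. pow x N \<cdot> pow x N = pow x N"
proof -
  obtain k where k: "\<And>x. 0 < k x" "\<And>x. pow x (k x) \<cdot> pow x (k x) = pow x (k x)"
    using ex_idem_pow by metis
  \<comment> \<open>A common multiple of the individual exponents; the factor 2 keeps
    \<open>N - 1\<close> positive.\<close>
  define N where "N = 2 * (\<Prod>x\<in>UNIV. k x)"
  have "pow x N \<cdot> pow x N = pow x N" for x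
  proof -
    have "k x dvd N"
      unfolding N_def by (intro dvd_mult dvd_prodI) auto
    moreover have "N > 0"
      unfolding N_def using k(1) by (simp add: prod_pos)
    ultimately obtain j where "N = k x * j" "0 < j"
      by (metis dvdE mult_0_right neq0_conv)
    then have "pow x N = pow x (k x)"
      using pow_mult[OF \<open>0 < j\<close> k(1)] pow_idem[OF \<open>0 < j\<close> k(2)] by simp
    then show ?thesis
      using k(2) by simp
  qed
  moreover have "(\<Prod>x\<in>UNIV. k x) > 0"
    using k(1) by (simp add: prod_pos)
  ultimately show ?thesis
    unfolding N_def by (metis One_nat_def Suc_leI mult.right_neutral mult_le_mono2)
qed

subsection \<open>The order of principal ideals\<close>

text \<open>The J-order: \<open>a\<close> lies in the ideal \<open>S^1 b S^1\<close>. Generating it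
  by one-sided multiplications avoids adjoining an identity.\<close>

inductive ideal_le :: "'a \<Rightarrow> 'a \<Rightarrow> bool" where
  ideal_le_refl: "ideal_le a a"
| ideal_le_left: "ideal_le a b \<Longrightarrow> ideal_le (s \<cdot> a) b"
| ideal_le_right: "ideal_le a b \<Longrightarrow> ideal_le (a \<cdot> s) b"

lemma ideal_le_trans [trans]: "ideal_le a b \<Longrightarrow> ideal_le b c \<Longrightarrow> ideal_le a c"
  by (induction rule: ideal_le.induct) (auto intro: ideal_le.intros)

text \<open>The outer factors \<open>s\<close> and \<open>t\<close> stand in for a possibly missing
  identity.\<close>

lemma ideal_le_mult:
  assumes "ideal_le a b"
  shows "\<exists>u v. s \<cdot> a \<cdot> t = u \<cdot> b \<cdot> v"
  using assms
proof (induction arbitrary: s t rule: ideal_le.induct)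
  case (ideal_le_left a b r)
  then show ?case
    using ideal_le_left.IH[of "s \<cdot> r" t] by (simp add: assoc)
next
  case (ideal_le_right a b r)
  then show ?case
    using ideal_le_right.IH[of s "r \<cdot> t"] by (simp add: assoc)
qed blast

lemma ideal_le_idem_left:
  assumes "ideal_le e w" "e \<cdot> e = e"
  shows "\<exists>u v. e = u \<cdot> w \<cdot> v"
  using ideal_le_mult[OF assms(1), of e e] assms(2) by simp

lemma ideal_le_idem_right:
  assumes "ideal_le w e" "e \<cdot> e = e"
  shows "\<exists>u v. w = u \<cdot> e \<cdot> v"
  using assms
proof (induction rule: ideal_le.induct)
  case (ideal_le_refl e)
  then have "e = e \<cdot> e \<cdot> e" by simp
  then show ?case by blast
next
  case (ideal_le_left a e s)
  then obtain u v where "a = u \<cdot> e \<cdot> v" by blast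
  then have "s \<cdot> a = (s \<cdot> u) \<cdot> e \<cdot> v" by (simp add: assoc)
  then show ?case by blast
next
  case (ideal_le_right a e s)
  then obtain u v where "a = u \<cdot> e \<cdot> v" by blast
  then have "a \<cdot> s = u \<cdot> e \<cdot> (v \<cdot> s)" by (simp add: assoc)
  then show ?case by blast
qed

lemma ideal_le_val: "w \<in> set ws \<Longrightarrow> ideal_le (val ws) w"
proof (induction ws)
  case (Cons u us)
  then show ?case
    by (cases "us = []") (auto simp: val_Cons intro: ideal_le.intros)
qed simp

lemma ideal_le_pow: "0 < k \<Longrightarrow> ideal_le (pow x k) x"
  by (simp add: pow_def ideal_le_val)

text \<open>Choose \<open>v\<close> in \<open>A\<close> with the most elements below it: going up
  enlarges that set, and equal cardinality forces equality.\<close>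

lemma ex_ideal_maximal:
  assumes "x \<in> A"
  shows "\<exists>v\<in>A. \<forall>w\<in>A. ideal_le v w \<longrightarrow> ideal_le w v"
proof -
  have "\<exists>v. v \<in> A \<and> (\<forall>w. w \<in> A \<longrightarrow> card {u. ideal_le u w} \<le> card {u. ideal_le u v})"
    by (rule ex_has_greatest_nat[of _ x _ "Suc (card (UNIV :: 'a set))"])
      (use assms in \<open>auto simp: less_Suc_eq_le intro: card_mono\<close>)
  then obtain v where v: "v \<in> A" "\<And>w. w \<in> A \<Longrightarrow> card {u. ideal_le u w} \<le> card {u. ideal_le u v}"
    by blast
  have "ideal_le w v" if "w \<in> A" "ideal_le v w" for w
  proof -
    have "{u. ideal_le u v} \<subseteq> {u. ideal_le u w}"
      using that(2) ideal_le_trans by blast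
    then have "{u. ideal_le u v} = {u. ideal_le u w}"
      using v(2)[OF that(1)] by (intro card_seteq) simp_all
    then show ?thesis
      using ideal_le_refl by blast
  qed
  with v(1) show ?thesis
    by blast
qed

text \<open>Stability of finite semigroups: an idempotent power \<open>p\<close> of \<open>a\<close> satisfies \<open>p \<cdot> x = x\<close>.\<close>

lemma stable:
  assumes "x = a \<cdot> x \<cdot> b"
  shows "\<exists>z. x = z \<cdot> (a \<cdot> x)"
proof -
  obtain N where N: "2 \<le> N" "\<And>x. pow x N \<cdot> pow x N = pow x N"
    using ex_uniform_idem_pow by blast
  have "x = pow a k \<cdot> x \<cdot> pow b k" if "0 < k" for k
    using that
  proof (induction k rule: nat_induct_non_zero)
    case 1
    then show ?case using assms by simp
  next
    case (Suc k)
    have "pow a (Suc k) \<cdot> x \<cdot> pow b (Suc k) = pow a k \<cdot> (a \<cdot> x \<cdot> b) \<cdot> pow b k"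
      unfolding pow_Suc[OF Suc.hyps, of b] pow_Suc2[OF Suc.hyps, of a] by (simp only: assoc)
    then show ?case
      using Suc.IH assms by simp
  qed
  then have x: "pow a N \<cdot> x \<cdot> pow b N = x"
    using N(1) by simp
  have "x = pow a N \<cdot> pow a N \<cdot> x \<cdot> pow b N"
    unfolding N(2) x ..
  also have "\<dots> = pow a N \<cdot> (pow a N \<cdot> x \<cdot> pow b N)"
    by (simp only: assoc)
  also have "\<dots> = pow a N \<cdot> x"
    unfolding x ..
  also have "\<dots> = pow a (N - 1) \<cdot> (a \<cdot> x)"
    using pow_Suc2[of "N - 1" a] N(1) by (simp add: assoc)
  finally show ?thesis
    by blast
qed

subsection \<open>Partial injections of the idempotents\<close>

text \<open>In a block-group every \<open>s\<close> induces a partial injection on the idempotents: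
  \<open>e\<close> is moved to \<open>g\<close> when \<open>e \<cdot> s = s \<cdot> g\<close> is R-related to \<open>e\<close> and L-related to \<open>g\<close>.\<close>

definition move :: "'a \<Rightarrow> 'a \<Rightarrow> 'a \<Rightarrow> bool" where
  "move e s g \<longleftrightarrow> e \<cdot> e = e \<and> g \<cdot> g = g \<and> e \<cdot> s = s \<cdot> g \<and> (\<exists>y. e \<cdot> s \<cdot> y = e \<and> y \<cdot> s \<cdot> g = g)"

lemma moveI:
  "e \<cdot> e = e \<Longrightarrow> g \<cdot> g = g \<Longrightarrow> e \<cdot> s = s \<cdot> g \<Longrightarrow> e \<cdot> s \<cdot> y = e \<Longrightarrow> y \<cdot> s \<cdot> g = g \<Longrightarrow> move e s g"
  unfolding move_def by blast

lemma moveE: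
  assumes "move e s g"
  obtains y where "e \<cdot> e = e" "g \<cdot> g = g" "e \<cdot> s = s \<cdot> g" "e \<cdot> s \<cdot> y = e" "y \<cdot> s \<cdot> g = g"
  using assms unfolding move_def by blast

text \<open>Since \<open>s \<cdot> g = s \<cdot> h\<close>, the idempotents \<open>g\<close> and
  \<open>h\<close> are L-related, and L-related idempotents of a block-group coincide.\<close>

lemma move_determ:
  assumes "move e s g" "move e s h"
  shows "g = h"
proof -
  obtain y where y: "g \<cdot> g = g" "e \<cdot> s = s \<cdot> g" "y \<cdot> s \<cdot> g = g"
    using assms(1) by (rule moveE)
  obtain z where z: "h \<cdot> h = h" "e \<cdot> s = s \<cdot> h" "z \<cdot> s \<cdot> h = h"
    using assms(2) by (rule moveE)
  have "g \<cdot> h = g" "h \<cdot> g = h"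
    using y z by (metis assoc)+
  then show ?thesis
    using left_block[of g h] y z by simp
qed

text \<open>Dually, \<open>e\<close> and \<open>d\<close> are R-related idempotents, which coincide
  in a block-group.\<close>

lemma move_inj:
  assumes "move e s g" "move d s g"
  shows "e = d"
proof -
  obtain y where y: "e \<cdot> e = e" "e \<cdot> s = s \<cdot> g" "e \<cdot> s \<cdot> y = e"
    using assms(1) by (rule moveE)
  obtain z where z: "d \<cdot> d = d" "d \<cdot> s = s \<cdot> g" "d \<cdot> s \<cdot> z = d"
    using assms(2) by (rule moveE)
  have "d \<cdot> e = e" "e \<cdot> d = d"
    using y z by (metis assoc)+
  then show ?thesis
    using right_block[of e d] y z by simp
qed

text \<open>The idempotent \<open>s \<cdot> t \<cdot> e\<close> is L-related to \<open>e\<close>,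
  hence equal to it; this makes \<open>t \<cdot> e \<cdot> s\<close> the image point.\<close>

lemma ex_move_right:
  assumes "e \<cdot> e = e" "e \<cdot> s \<cdot> t = e"
  shows "\<exists>g. move e s g"
proof -
  have "s \<cdot> t \<cdot> e \<cdot> (s \<cdot> t \<cdot> e) = s \<cdot> t \<cdot> e"
    using assms by (metis assoc)
  moreover have "e \<cdot> (s \<cdot> t \<cdot> e) = e" "s \<cdot> t \<cdot> e \<cdot> e = s \<cdot> t \<cdot> e"
    using assms by (metis assoc)+
  ultimately have e: "s \<cdot> t \<cdot> e = e"
    using left_block[of e "s \<cdot> t \<cdot> e"] assms by simp
  have "move e s (t \<cdot> e \<cdot> s)"
    by (rule moveI[where y = "t \<cdot> e"]) (use assms e in \<open>simp_all add: assoc; metis assoc\<close>)+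
  then show ?thesis by blast
qed

text \<open>Dually, \<open>g \<cdot> t \<cdot> s\<close> is an idempotent R-related to
  \<open>g\<close>, hence equal to it.\<close>

lemma ex_move_left:
  assumes "g \<cdot> g = g" "t \<cdot> s \<cdot> g = g"
  shows "\<exists>e. move e s g"
proof -
  have "g \<cdot> t \<cdot> s \<cdot> (g \<cdot> t \<cdot> s) = g \<cdot> t \<cdot> s"
    using assms by (metis assoc)
  moreover have "g \<cdot> t \<cdot> s \<cdot> g = g" "g \<cdot> (g \<cdot> t \<cdot> s) = g \<cdot> t \<cdot> s"
    using assms by (metis assoc)+
  ultimately have g: "g \<cdot> t \<cdot> s = g"
    using right_block[of g "g \<cdot> t \<cdot> s"] assms by simp
  have "move (s \<cdot> g \<cdot> t) s g"
    by (rule moveI[where y = "g \<cdot> t"]) (use assms g in \<open>simp_all add: assoc; metis assoc\<close>)+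
  then show ?thesis by blast
qed

lemma move_comp:
  assumes "move e s g" "move g t h"
  shows "move e (s \<cdot> t) h"
proof -
  obtain y where y: "e \<cdot> e = e" "g \<cdot> g = g" "e \<cdot> s = s \<cdot> g" "e \<cdot> s \<cdot> y = e" "y \<cdot> s \<cdot> g = g"
    using assms(1) by (rule moveE)
  obtain z where z: "h \<cdot> h = h" "g \<cdot> t = t \<cdot> h" "g \<cdot> t \<cdot> z = g" "z \<cdot> t \<cdot> h = h"
    using assms(2) by (rule moveE)
  show ?thesis
  proof (rule moveI[where y = "z \<cdot> y"])
    show "e \<cdot> (s \<cdot> t) = s \<cdot> t \<cdot> h"
      using y(3) z(2) by (metis assoc)
    have "e \<cdot> (s \<cdot> t) \<cdot> (z \<cdot> y) = s \<cdot> (g \<cdot> t \<cdot> z) \<cdot> y"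
      using y(3) by (metis assoc)
    then show "e \<cdot> (s \<cdot> t) \<cdot> (z \<cdot> y) = e"
      using y(3,4) z(3) by simp
    have "z \<cdot> y \<cdot> (s \<cdot> t) \<cdot> h = z \<cdot> (y \<cdot> s \<cdot> g) \<cdot> t"
      using z(2) by (metis assoc)
    then show "z \<cdot> y \<cdot> (s \<cdot> t) \<cdot> h = h"
      using y(5) z(2,4) by (metis assoc)
  qed (use y z in auto)
qed

text \<open>A witness \<open>y\<close> for the product makes \<open>t \<cdot> y\<close> a right
  inverse of \<open>s\<close> at \<open>e\<close>, and \<open>y \<cdot> e \<cdot> s\<close> one of
  \<open>t\<close> at the image \<open>g\<close>; determinism identifies the endpoint.\<close>

lemma move_mult_iff: "move e (s \<cdot> t) h \<longleftrightarrow> (\<exists>g. move e s g \<and> move g t h)"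
proof
  assume mv: "move e (s \<cdot> t) h"
  then obtain y where y: "e \<cdot> e = e" "e \<cdot> (s \<cdot> t) \<cdot> y = e"
    by (rule moveE)
  then obtain g where g: "move e s g"
    using ex_move_right[of e s "t \<cdot> y"] by (auto simp: assoc)
  then obtain z where z: "g \<cdot> g = g" "e \<cdot> s = s \<cdot> g" "z \<cdot> s \<cdot> g = g"
    by (rule moveE)
  have "g \<cdot> t \<cdot> (y \<cdot> e \<cdot> s) = z \<cdot> (e \<cdot> (s \<cdot> t) \<cdot> y) \<cdot> e \<cdot> s"
    using z by (metis assoc)
  also have "\<dots> = g"
    using y z by (metis assoc)
  finally obtain h' where "move g t h'"
    using ex_move_right[OF z(1)] by blast
  then show "\<exists>g. move e s g \<and> move g t h"
    using g move_comp move_determ mv by metis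
qed (blast intro: move_comp)

text \<open>Here \<open>e \<cdot> s\<close> is idempotent and R-related to \<open>e\<close>, so it
  equals \<open>e\<close>; then \<open>e\<close> and \<open>g\<close> are L-related and
  coincide.\<close>

lemma move_idem:
  assumes "move e s g" "s \<cdot> s = s"
  shows "g = e" "e \<cdot> s = e" "s \<cdot> e = e"
proof -
  obtain y where y: "e \<cdot> e = e" "g \<cdot> g = g" "e \<cdot> s = s \<cdot> g" "e \<cdot> s \<cdot> y = e" "y \<cdot> s \<cdot> g = g"
    using assms(1) by (rule moveE)
  have "s \<cdot> (e \<cdot> s) = e \<cdot> s"
    using y(3) assms(2) by (metis assoc)
  then have x: "e \<cdot> s \<cdot> (e \<cdot> s) = e \<cdot> s"
    using y(1) by (metis assoc)
  have xe: "e \<cdot> s \<cdot> e = e"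
    using x y(4) by (metis assoc)
  have ex: "e \<cdot> (e \<cdot> s) = e \<cdot> s"
    using y(1) by (metis assoc)
  show es: "e \<cdot> s = e"
    using right_block[of e "e \<cdot> s"] x xe ex y(1) by simp
  have "e \<cdot> g = e" "g \<cdot> e = g"
    using es y by (metis assoc)+
  then show "g = e"
    using left_block[of g e] y by simp
  then show "s \<cdot> e = e"
    using es y(3) by simp
qed

lemma move_ideal_le:
  assumes "move e s g"
  shows "ideal_le e g" "ideal_le g e"
proof -
  obtain y where y: "e \<cdot> s = s \<cdot> g" "e \<cdot> s \<cdot> y = e" "y \<cdot> s \<cdot> g = g"
    using assms by (rule moveE)
  have "e = s \<cdot> g \<cdot> y" "g = y \<cdot> (e \<cdot> s)"
    using y by (simp_all add: assoc)
  then show "ideal_le e g" "ideal_le g e"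
    using ideal_le.intros by metis+
qed

text \<open>An element of the J-class of \<open>e\<close> acts with a one-point domain.\<close>

lemma move_rank_one:
  assumes "move e s g" "ideal_le s e"
  shows "e \<cdot> s = s"
proof -
  obtain y where y: "e \<cdot> e = e" "g \<cdot> g = g" "e \<cdot> s = s \<cdot> g" "e \<cdot> s \<cdot> y = e"
    using assms(1) by (rule moveE)
  obtain u v where "s = u \<cdot> e \<cdot> v"
    using ideal_le_idem_right[OF assms(2) y(1)] by blast
  \<comment> \<open>Writing the middle \<open>e\<close> as \<open>e \<cdot> s \<cdot> y\<close> sets
    up stability, which puts \<open>s\<close> into the left ideal of
    \<open>e \<cdot> s = s \<cdot> g\<close>; hence \<open>s \<cdot> g = s\<close>.\<close>
  then have "s = (u \<cdot> e) \<cdot> s \<cdot> (y \<cdot> v)"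
    using y(4) by (metis assoc)
  then obtain z where "s = z \<cdot> (u \<cdot> e \<cdot> s)"
    using stable by blast
  then show ?thesis
    using y(2,3) by (metis assoc)
qed

text \<open>Both \<open>e\<close> and \<open>d\<close> are left identities of \<open>s\<close> and
  right multiples of \<open>s\<close>, so they are R-related.\<close>

lemma move_rank_one_unique:
  assumes "move e s g" "ideal_le s e" "move d s h" "ideal_le s d"
  shows "e = d" "g = h"
proof -
  obtain y where y: "e \<cdot> e = e" "e \<cdot> s \<cdot> y = e"
    using assms(1) by (rule moveE)
  obtain z where z: "d \<cdot> d = d" "d \<cdot> s \<cdot> z = d"
    using assms(3) by (rule moveE)
  have "e \<cdot> s = s" "d \<cdot> s = s"
    using assms move_rank_one by blast+
  then have "e \<cdot> d = d" "d \<cdot> e = e"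
    using y z by (metis assoc)+
  then show "e = d"
    using right_block[of e d] y z by simp
  then show "g = h"
    using assms move_determ by blast
qed

section \<open>Walks of points along words\<close>

primrec moves :: "'a \<Rightarrow> 'a list \<Rightarrow> 'a \<Rightarrow> bool" where
  "moves e [] g \<longleftrightarrow> e = g"
| "moves e (s # ss) g \<longleftrightarrow> (\<exists>d. move e s d \<and> moves d ss g)"

lemma moves_append: "moves e (us @ vs) g \<longleftrightarrow> (\<exists>d. moves e us d \<and> moves d vs g)"
  by (induction us arbitrary: e) auto

lemma move_val_iff: "ws \<noteq> [] \<Longrightarrow> move e (val ws) g \<longleftrightarrow> moves e ws g"
proof (induction ws arbitrary: e)
  case (Cons w ws)
  then show ?case
    by (cases "ws = []") (auto simp: val_Cons move_mult_iff)
qed simp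

lemma moves_inj: "moves e ws g \<Longrightarrow> moves d ws g \<Longrightarrow> e = d"
  by (induction ws arbitrary: e d) (auto dest: move_inj)

lemma moves_ideal_le: "moves e ws g \<Longrightarrow> ideal_le e g \<and> ideal_le g e"
proof (induction ws arbitrary: e)
  case (Cons w ws)
  then obtain d where "move e w d" "ideal_le d g" "ideal_le g d"
    by auto
  then show ?case
    using move_ideal_le[of e w d] ideal_le_trans by blast
qed (simp add: ideal_le_refl)

text \<open>Walking through \<open>ws\<close> and through its reversal, each partial identity keeps the two current
  points, and each map with a one-point domain interchanges them.\<close>

lemma moves_rev_swap:
  assumes "moves a ws a'" "moves b (rev ws) b'" "ideal_le a b" "ideal_le b a"
    and "\<And>w. w \<in> set ws \<Longrightarrow> w \<cdot> w = w \<or> ideal_le w a"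
  shows "{a, b'} = {a', b}"
  using assms
proof (induction ws arbitrary: a b')
  case (Cons w ws)
  obtain a1 where a1: "move a w a1" "moves a1 ws a'"
    using Cons.prems(1) by auto
  obtain b1 where b1: "moves b (rev ws) b1" "move b1 w b'"
    using Cons.prems(2) by (auto simp: moves_append)
  note aa1 = move_ideal_le[OF a1(1)]
  have IH: "{a1, b1} = {a', b}"
  proof (rule Cons.IH[OF a1(2) b1(1)])
    show "ideal_le a1 b" "ideal_le b a1"
      using aa1 Cons.prems(3,4) ideal_le_trans by blast+
    show "u \<cdot> u = u \<or> ideal_le u a1" if "u \<in> set ws" for u
      using Cons.prems(5)[of u] that ideal_le_trans[OF _ aa1(1)] by auto
  qed
  show ?case
  proof (cases "w \<cdot> w = w")
    case True
    then show ?thesis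
      using IH move_idem(1)[OF a1(1)] move_idem(1)[OF b1(2)] by simp
  next
    case False
    then have wa: "ideal_le w a"
      using Cons.prems(5)[of w] by simp
    also have "ideal_le a b"
      by (rule Cons.prems(3))
    also have "ideal_le b b1"
      using moves_ideal_le[OF b1(1)] by simp
    finally have wb1: "ideal_le w b1" .
    \<comment> \<open>Both walks pass through \<open>w\<close>, one from \<open>a\<close> and the
      other from \<open>b1\<close>, but \<open>w\<close> has a single point in its domain.\<close>
    have "a = b1" "a1 = b'"
      using move_rank_one_unique[OF a1(1) wa b1(2) wb1] by simp_all
    then show ?thesis
      using IH by (simp add: insert_commute)
  qed
qed simp

subsection \<open>Maximal subgroups\<close>

text \<open>The H-class of \<open>e\<close>, that is, the group of units of \<open>e S e\<close>.
  The element \<open>y\<close> ranges over the whole semigroup; \<open>e \<cdot> y \<cdot> e\<close>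
  is then an inverse inside the group.\<close>

definition max_subgroup :: "'a \<Rightarrow> 'a set" where
  "max_subgroup e = {x. e \<cdot> x = x \<and> x \<cdot> e = x \<and> (\<exists>y. x \<cdot> y = e \<and> y \<cdot> x = e)}"

lemma move_max_subgroup:
  assumes "x \<in> max_subgroup e" "e \<cdot> e = e"
  shows "move e x e"
  using assms unfolding max_subgroup_def by (auto intro!: moveI)

lemma max_subgroupI:
  assumes "move e x e" "x \<cdot> e = x"
  shows "x \<in> max_subgroup e"
proof -
  obtain y where y: "e \<cdot> x = x \<cdot> e" "e \<cdot> x \<cdot> y = e" "y \<cdot> x \<cdot> e = e"
    using assms(1) by (rule moveE)
  with assms(2) show ?thesis
    unfolding max_subgroup_def by (auto simp: assoc)
qed

lemma idem_max_subgroup: "e \<cdot> e = e \<Longrightarrow> e \<in> max_subgroup e"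
  unfolding max_subgroup_def by auto

lemma idem_in_max_subgroup:
  assumes "x \<in> max_subgroup e" "x \<cdot> x = x"
  shows "x = e"
  using assms unfolding max_subgroup_def by (auto, metis assoc)

lemma group_max_subgroup:
  assumes e: "e \<cdot> e = e"
  shows "group (restricted f (max_subgroup e) e)"
proof (rule groupI; unfold restricted_def; simp)
  show "e \<in> max_subgroup e"
    by (rule idem_max_subgroup[OF e])
  show "x \<cdot> y \<in> max_subgroup e" if x: "x \<in> max_subgroup e" and y: "y \<in> max_subgroup e" for x y
  proof (rule max_subgroupI)
    show "move e (x \<cdot> y) e"
      using move_comp move_max_subgroup x y e by blast
    show "x \<cdot> y \<cdot> e = x \<cdot> y"
      using y unfolding max_subgroup_def by (simp add: assoc)
  qed
  show "\<exists>y\<in>max_subgroup e. y \<cdot> x = e" if x: "x \<in> max_subgroup e" for x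
  proof -
    obtain y where y: "e \<cdot> x = x" "x \<cdot> e = x" "x \<cdot> y = e" "y \<cdot> x = e"
      using x unfolding max_subgroup_def by blast
    have "e \<cdot> y \<cdot> e \<cdot> x = e" "x \<cdot> (e \<cdot> y \<cdot> e) = e"
      "e \<cdot> (e \<cdot> y \<cdot> e) = e \<cdot> y \<cdot> e" "e \<cdot> y \<cdot> e \<cdot> e = e \<cdot> y \<cdot> e"
      using y e by (metis assoc)+
    then show ?thesis
      unfolding max_subgroup_def by blast
  qed
  show "x \<cdot> y \<cdot> z = x \<cdot> (y \<cdot> z)" for x y z
    by (rule assoc)
  show "e \<cdot> x = x" if "x \<in> max_subgroup e" for x
    using that unfolding max_subgroup_def by blast
qed

text \<open>The fold yields \<open>e\<close> on the empty list, where \<open>val\<close> is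
  undefined; this allows the two halves of a pattern to be treated separately even if one is
  empty.\<close>

lemma foldr_eq_val:
  assumes "ws \<noteq> []" "set ws \<subseteq> max_subgroup e"
  shows "foldr f ws e = val ws"
  using assms
proof (induction ws)
  case (Cons w ws)
  then show ?case
    by (cases "ws = []") (auto simp: val_Cons max_subgroup_def)
qed simp

end

section \<open>Values of the words\<close>

text \<open>The exponent makes \<open>x^(2m)\<close> idempotent and puts \<open>x^(2m-1)\<close>
  into the subgroup at that idempotent, where it is inverse to
  \<open>x \<cdot> x^(2m)\<close>.\<close>

locale block_group_exponent = finite_block_group f
  for f :: "'a::finite \<Rightarrow> 'a \<Rightarrow> 'a" (infixl \<open>\<cdot>\<close> 70) +
  fixes m :: nat
  assumes exponent_pos: "0 < m"
    and pow_exponent_idem: "pow x (2 * m) \<cdot> pow x (2 * m) = pow x (2 * m)"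
    and pow_exponent_absorb: "pow x (2 * m - 1) \<cdot> pow x (2 * m) = pow x (2 * m - 1)"
begin

text \<open>The two halves are separate lists of arbitrary lengths, which makes all later arguments
  uniform in \<open>n\<close>.\<close>

definition pat :: "'a list \<Rightarrow> 'a list \<Rightarrow> 'a" where
  "pat us vs = val (us @ vs) \<cdot> pow (val (rev us @ vs)) (2 * m - 1)"

lemma pow_exponent_Suc:
  "pow x (2 * m - 1) \<cdot> x = pow x (2 * m)" "x \<cdot> pow x (2 * m - 1) = pow x (2 * m)"
  using pow_Suc2[of "2 * m - 1" x] pow_Suc[of "2 * m - 1" x] exponent_pos by simp_all

lemma move_pow_exponent: "move (pow x (2 * m)) x (pow x (2 * m))"
proof (rule moveI[where y = "pow x (2 * m - 1)"])
  show "pow x (2 * m) \<cdot> x = x \<cdot> pow x (2 * m)"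
    using pow_Suc[of "2 * m" x] pow_Suc2[of "2 * m" x] exponent_pos by simp
  show "pow x (2 * m) \<cdot> x \<cdot> pow x (2 * m - 1) = pow x (2 * m)"
    by (simp only: assoc pow_exponent_Suc pow_exponent_idem)
  show "pow x (2 * m - 1) \<cdot> x \<cdot> pow x (2 * m) = pow x (2 * m)"
    by (simp only: pow_exponent_Suc pow_exponent_idem)
qed (rule pow_exponent_idem)+

section \<open>The pattern at idempotent letters\<close>

lemma val_absorb:
  assumes "ws \<noteq> []" "\<And>w. w \<in> set ws \<Longrightarrow> w \<cdot> e = e"
  shows "val ws \<cdot> e = e"
  using assms
proof (induction ws)
  case (Cons w ws)
  then show ?case
    by (cases "ws = []") (simp_all add: val_Cons assoc)
qed simp

lemma pow_absorb: "0 < k \<Longrightarrow> x \<cdot> e = e \<Longrightarrow> pow x k \<cdot> e = e"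
  by (auto simp: pow_def intro: val_absorb)

lemma moves_idem_fixed:
  assumes "moves e ws g" "\<And>w. w \<in> set ws \<Longrightarrow> w \<cdot> w = w" "w \<in> set ws"
  shows "w \<cdot> e = e"
  using assms
proof (induction ws)
  case (Cons u us)
  then obtain d where d: "move e u d" "moves d us g"
    by auto
  have "u \<cdot> u = u"
    by (rule Cons.prems(2)) simp
  with d(1) have "d = e" "u \<cdot> e = e"
    using move_idem by blast+
  then show ?case
    using Cons d by auto
qed simp

text \<open>The idempotent power \<open>e\<close> of the bracketed product is fixed all along its
  letters, so every letter acts as a left identity on \<open>e\<close> and the pattern collapses to
  \<open>e\<close>.\<close>

lemma pat_idem:
  assumes ne: "us @ vs \<noteq> []" and idem: "\<And>w. w \<in> set (us @ vs) \<Longrightarrow> w \<cdot> w = w"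
  shows "pat us vs \<cdot> pat us vs = pat us vs"
proof -
  define b where "b = val (rev us @ vs)"
  define e where "e = pow b (2 * m)"
  have "moves e (rev us @ vs) e"
    using move_pow_exponent[of b] move_val_iff[of "rev us @ vs"] ne unfolding e_def b_def by simp
  then have fixed: "w \<cdot> e = e" if "w \<in> set (us @ vs)" for w
    using that idem by (auto intro: moves_idem_fixed)
  have a: "val (us @ vs) \<cdot> e = e"
    by (rule val_absorb[OF ne fixed])
  have "b \<cdot> e = e"
    unfolding b_def using ne fixed by (intro val_absorb) auto
  then have "pow b (2 * m - 1) \<cdot> e = e"
    using exponent_pos by (intro pow_absorb) simp_all
  then have "pow b (2 * m - 1) = e"
    using pow_exponent_absorb[of b] e_def by simp
  then have "pat us vs = e"
    using a unfolding pat_def b_def by simp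
  then show ?thesis
    using pow_exponent_idem e_def by simp
qed

section \<open>The pattern and maximal subgroups\<close>

lemma pat_mult_commuting:
  assumes ne: "us @ vs \<noteq> []" and e: "e \<cdot> e = e"
    and comm: "\<And>w. w \<in> set (us @ vs) \<Longrightarrow> e \<cdot> w = w \<cdot> e"
  shows "pat (map (\<lambda>w. w \<cdot> e) us) (map (\<lambda>w. w \<cdot> e) vs) = pat us vs \<cdot> e"
proof -
  define b where "b = val (rev us @ vs)"
  define p where "p = pow b (2 * m - 1)"
  have m1: "0 < 2 * m - 1"
    using exponent_pos by simp
  have ne': "rev us @ vs \<noteq> []" and comm': "\<And>w. w \<in> set (rev us @ vs) \<Longrightarrow> e \<cdot> w = w \<cdot> e"
    using ne comm by auto
  have eb: "e \<cdot> b = b \<cdot> e"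
    unfolding b_def by (rule val_commute[OF ne' comm'])
  have ep: "e \<cdot> p = p \<cdot> e"
    unfolding p_def pow_def by (rule val_commute) (use m1 eb in \<open>auto split: if_splits\<close>)
  have "pat (map (\<lambda>w. w \<cdot> e) us) (map (\<lambda>w. w \<cdot> e) vs)
      = val (map (\<lambda>w. w \<cdot> e) (us @ vs)) \<cdot> pow (val (map (\<lambda>w. w \<cdot> e) (rev us @ vs))) (2 * m - 1)"
    by (simp add: pat_def rev_map)
  also have "\<dots> = val (us @ vs) \<cdot> e \<cdot> pow (b \<cdot> e) (2 * m - 1)"
  proof -
    have "val (map (\<lambda>w. w \<cdot> e) (us @ vs)) = val (us @ vs) \<cdot> e"
      by (rule val_map_commuting[OF ne e comm])
    moreover have "val (map (\<lambda>w. w \<cdot> e) (rev us @ vs)) = b \<cdot> e"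
      unfolding b_def by (rule val_map_commuting[OF ne' e comm'])
    ultimately show ?thesis
      by (simp only:)
  qed
  also have "\<dots> = val (us @ vs) \<cdot> e \<cdot> (p \<cdot> e)"
    unfolding p_def pow_mult_commuting[OF m1 e eb] ..
  also have "\<dots> = val (us @ vs) \<cdot> (e \<cdot> p) \<cdot> e"
    by (simp only: assoc)
  also have "\<dots> = val (us @ vs) \<cdot> p \<cdot> e"
    unfolding ep by (simp only: assoc e)
  finally show ?thesis
    unfolding pat_def p_def b_def .
qed

text \<open>In a group the power \<open>2m - 1\<close> is an inverse, so the pattern becomes
  \<open>a c (r c)^(-1) = a r^(-1)\<close>, where \<open>a\<close> is the product of
  \<open>us\<close> and \<open>r\<close> that of its reversal. These agree modulo the derived
  subgroup.\<close>

lemma pat_derived: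
  assumes e: "e \<cdot> e = e" and H: "subgroup H (restricted f (max_subgroup e) e)"
    and ne: "us @ vs \<noteq> []" and sub: "set (us @ vs) \<subseteq> H"
  shows "pat us vs \<in> derived (restricted f (max_subgroup e) e) H"
proof -
  define G where "G = restricted f (max_subgroup e) e"
  interpret G: group G
    unfolding G_def by (rule group_max_subgroup[OF e])
  have [simp]: "carrier G = max_subgroup e" "mult G = f" "one G = e"
    by (simp_all add: G_def restricted_def)
  have HG: "subgroup H G"
    using H by (simp add: G_def)
  then have sub': "set (us @ vs) \<subseteq> max_subgroup e"
    using sub subgroup.subset by fastforce
  define a where "a = foldr f us e"
  define r where "r = foldr f (rev us) e"
  define c where "c = foldr f vs e"
  have carr: "a \<in> max_subgroup e" "r \<in> max_subgroup e" "c \<in> max_subgroup e"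
    using G.foldr_mult_closed[OF G.subgroup_self] sub' by (auto simp: a_def r_def c_def)
  have ac: "val (us @ vs) = a \<cdot> c"
    using G.foldr_mult_append[of us vs] foldr_eq_val[OF ne sub'] sub' by (simp add: a_def c_def)
  have rc: "val (rev us @ vs) = r \<cdot> c"
    using G.foldr_mult_append[of "rev us" vs] foldr_eq_val[of "rev us @ vs" e] ne sub'
    by (simp add: r_def c_def)
  have rcG: "r \<cdot> c \<in> max_subgroup e"
    using G.m_closed carr by simp
  have pG: "pow x k \<in> max_subgroup e" if "x \<in> max_subgroup e" "0 < k" for x k
    using that(2)
  proof (induction k rule: nat_induct_non_zero)
    case (Suc k)
    then show ?case
      using G.m_closed[of x "pow x k"] that(1) by (simp add: pow_Suc)
  qed (use that(1) in simp)
  have "pow (r \<cdot> c) (2 * m) = e"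
    using idem_in_max_subgroup[OF pG[OF rcG]] pow_exponent_idem exponent_pos by simp
  then have "pow (r \<cdot> c) (2 * m - 1) = inv\<^bsub>G\<^esub> (r \<cdot> c)"
    using G.inv_equality[of "pow (r \<cdot> c) (2 * m - 1)" "r \<cdot> c"] pow_exponent_Suc(1)[of "r \<cdot> c"]
      pG[OF rcG, of "2 * m - 1"] rcG exponent_pos by simp
  then have "pat us vs = a \<cdot> c \<cdot> (inv\<^bsub>G\<^esub> c \<cdot> inv\<^bsub>G\<^esub> r)"
    using G.inv_mult_group[of r c] carr by (simp add: pat_def ac rc)
  also have "\<dots> = a \<cdot> (c \<cdot> inv\<^bsub>G\<^esub> c) \<cdot> inv\<^bsub>G\<^esub> r"
    by (simp only: assoc)
  also have "\<dots> = a \<cdot> inv\<^bsub>G\<^esub> r"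
    using G.r_inv[of c] G.r_one[of a] carr by simp
  also have "\<dots> \<in> derived G H"
    using G.foldr_mult_rev_derived[OF HG, of us] sub by (simp add: a_def r_def)
  finally show ?thesis
    by (simp add: G_def)
qed

text \<open>If some letter lies in the J-class of the value and the others are idempotent or in the
  same J-class, the value is R-related to the idempotent \<open>g\<close> and L-related to \<open>e\<close>, and
  comparing the walks from \<open>g\<close> along \<open>us @ vs\<close> and from \<open>e\<close> along \<open>rev us @ vs\<close> gives \<open>g = e\<close>.\<close>

lemma pat_in_max_subgroup:
  assumes v: "v = pat us vs"
    and u: "u \<in> set (us @ vs)" "ideal_le u v"
    and ws: "\<And>w. w \<in> set (us @ vs) \<Longrightarrow> w \<cdot> w = w \<or> ideal_le w v"
  obtains e where "e \<cdot> e = e" "v \<in> max_subgroup e" "moves e (us @ vs) e" "ideal_le v e"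
proof -
  define a where "a = val (us @ vs)"
  define b where "b = val (rev us @ vs)"
  define e where "e = pow b (2 * m)"
  have e: "e \<cdot> e = e"
    unfolding e_def by (rule pow_exponent_idem)
  have ne: "us @ vs \<noteq> []" "rev us @ vs \<noteq> []"
    using u(1) by auto
  have vab: "v = a \<cdot> pow b (2 * m - 1)"
    by (simp add: v pat_def a_def b_def)
  have pe: "pow b (2 * m - 1) \<cdot> e = pow b (2 * m - 1)"
    unfolding e_def by (rule pow_exponent_absorb)
  have ve: "v \<cdot> e = v"
    unfolding vab by (simp only: assoc pe)
  \<comment> \<open>The chain from \<open>e\<close> through \<open>b\<close> and the letter
    \<open>u\<close> down to \<open>v\<close>, together with \<open>v \<cdot> e = v\<close>, makes
    \<open>e\<close> and \<open>v\<close> J-equivalent.\<close>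
  have "ideal_le e b"
    unfolding e_def using exponent_pos by (intro ideal_le_pow) simp
  also have "ideal_le b u"
    unfolding b_def by (rule ideal_le_val) (use u(1) in auto)
  also note u(2)
  finally have ev_le: "ideal_le e v" .
  have ve_le: "ideal_le v e"
    using ideal_le_left[OF ideal_le_refl, of v e] ve by simp
  have mb: "move e b e"
    unfolding e_def by (rule move_pow_exponent)
  have mp: "move e (pow b k) e" if "0 < k" for k
    using that
  proof (induction k rule: nat_induct_non_zero)
    case (Suc k)
    then show ?case
      using move_comp[OF mb] by (simp add: pow_Suc)
  qed (use mb in simp)
  have "e \<cdot> pow b (2 * m - 1) = pow b (2 * m - 1) \<cdot> e"
    using mp[of "2 * m - 1"] exponent_pos by (auto elim: moveE)
  \<comment> \<open>Commuting \<open>e\<close> past the power puts it next to \<open>a\<close>, so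
    \<open>e\<close> lies in the ideal of \<open>a \<cdot> e\<close>. Stability makes it a left
    multiple, which provides a preimage \<open>g\<close> of \<open>e\<close> under
    \<open>a\<close>.\<close>
  then have "v = a \<cdot> e \<cdot> pow b (2 * m - 1)"
    using pe by (simp add: vab assoc)
  then have "ideal_le v (a \<cdot> e)"
    using ideal_le_right[OF ideal_le_refl] by simp
  then obtain s t where "e = s \<cdot> (a \<cdot> e) \<cdot> t"
    using ideal_le_idem_left[OF ideal_le_trans[OF ev_le] e] by blast
  then have "e = (s \<cdot> a) \<cdot> e \<cdot> t"
    by (simp only: assoc)
  then obtain z where "e = z \<cdot> (s \<cdot> a \<cdot> e)"
    using stable by blast
  then have "(z \<cdot> s) \<cdot> a \<cdot> e = e"
    by (simp only: assoc)
  then obtain g where ga: "move g a e"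
    using ex_move_left[OF e] by blast
  obtain c where gc: "moves g us c" "moves c vs e"
    using ga move_val_iff[OF ne(1)] by (auto simp: a_def moves_append)
  obtain c' where ec: "moves e (rev us) c'" "moves c' vs e"
    using mb move_val_iff[OF ne(2)] by (auto simp: b_def moves_append)
  \<comment> \<open>Both walks reach \<open>e\<close> after reading \<open>vs\<close>, so by
    injectivity they agree at the point between the halves.\<close>
  have cc: "c' = c"
    by (rule moves_inj[OF ec(2) gc(2)])
  have eg: "ideal_le e g" "ideal_le g e"
    using move_ideal_le[OF ga] by blast+
  have vg: "ideal_le v g"
    by (rule ideal_le_trans[OF ve_le eg(1)])
  have "{g, c} = {c, e}"
  proof (rule moves_rev_swap[OF gc(1) ec(1)[unfolded cc] eg(2,1)])
    show "w \<cdot> w = w \<or> ideal_le w g" if "w \<in> set us" for w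
      using ws[of w] that ideal_le_trans[OF _ vg] by auto
  qed
  then have "g = e"
    by (auto simp: doubleton_eq_iff)
  with ga have ma: "move e a e"
    by simp
  have "move e v e"
    unfolding vab using exponent_pos by (intro move_comp[OF ma mp]) simp
  then have "v \<in> max_subgroup e"
    using ve by (rule max_subgroupI)
  moreover have "moves e (us @ vs) e"
    using ma move_val_iff[OF ne(1)] by (simp add: a_def)
  ultimately show thesis
    using that e ve_le by blast
qed

text \<open>An idempotent letter is a partial identity; any other letter lies in a maximal subgroup,
  whose identity is its only domain point. Either way the walk stays at \<open>e\<close>.\<close>

lemma moves_max_subgroup_fixed:
  assumes "moves e ws g" "ideal_le v e"
    and "\<And>w. w \<in> set ws \<Longrightarrow> w \<cdot> w = w \<or> ideal_le w v \<and> (\<exists>d. d \<cdot> d = d \<and> w \<in> max_subgroup d)"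
    and "w \<in> set ws"
  shows "e \<cdot> w = w \<cdot> e" "w \<cdot> e = e \<or> w \<cdot> e = w \<and> w \<in> max_subgroup e"
proof -
  have "e \<cdot> w = w \<cdot> e \<and> (w \<cdot> e = e \<or> w \<cdot> e = w \<and> w \<in> max_subgroup e)"
    using assms(1,3,4)
  proof (induction ws)
    case (Cons u us)
    then obtain d where d: "move e u d" "moves d us g"
      by auto
    have "d = e \<and> e \<cdot> u = u \<cdot> e \<and> (u \<cdot> e = e \<or> u \<cdot> e = u \<and> u \<in> max_subgroup e)"
    proof (cases "u \<cdot> u = u")
      case True
      then show ?thesis
        using move_idem[OF d(1)] by simp
    next
      case False
      then obtain h where h: "ideal_le u v" "h \<cdot> h = h" "u \<in> max_subgroup h"
        using Cons.prems(2)[of u] by auto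
      have hu: "h \<cdot> u = u" "u \<cdot> h = u"
        using h(3) by (simp_all add: max_subgroup_def)
      have "ideal_le u h"
        using ideal_le_right[OF ideal_le_refl, of h u] hu(1) by simp
      then have "e = h" "d = h"
        using move_rank_one_unique[OF d(1) ideal_le_trans[OF h(1) assms(2)]
            move_max_subgroup[OF h(3,2)]] by blast+
      then show ?thesis
        using hu h(3) by simp
    qed
    then show ?case
      using Cons d by auto
  qed simp
  then show "e \<cdot> w = w \<cdot> e" "w \<cdot> e = e \<or> w \<cdot> e = w \<and> w \<in> max_subgroup e"
    by blast+
qed

section \<open>Sets reproduced by the pattern\<close>

lemma closed_set_idem:
  assumes V: "\<And>v. v \<in> V \<Longrightarrow> \<exists>us vs. us @ vs \<noteq> [] \<and> set (us @ vs) \<subseteq> V \<and> v = pat us vs"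
    and solv: "all_subgroups_solvable f" and "x \<in> V"
  shows "x \<cdot> x = x"
proof (rule ccontr)
  assume "x \<cdot> x \<noteq> x"
  then have "x \<in> {v \<in> V. v \<cdot> v \<noteq> v}"
    using \<open>x \<in> V\<close> by simp
  then obtain z where z: "z \<in> V" "z \<cdot> z \<noteq> z"
    and zmax: "\<And>w. w \<in> V \<Longrightarrow> w \<cdot> w \<noteq> w \<Longrightarrow> ideal_le z w \<Longrightarrow> ideal_le w z"
    using ex_ideal_maximal[of x "{v \<in> V. v \<cdot> v \<noteq> v}"] by blast
  \<comment> \<open>All letters lie J-above \<open>v\<close>, so by maximality the non-idempotent
    ones lie in its J-class. At least one exists, since the pattern at idempotents is
    idempotent.\<close>
  have decomp: "\<exists>us vs u. us @ vs \<noteq> [] \<and> set (us @ vs) \<subseteq> V \<and> v = pat us vs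
      \<and> u \<in> set (us @ vs) \<and> ideal_le u v \<and> (\<forall>w\<in>set (us @ vs). w \<cdot> w = w \<or> ideal_le w v)"
    if v: "v \<in> V" "v \<cdot> v \<noteq> v" "ideal_le v z" "ideal_le z v" for v
  proof -
    obtain us vs where d: "us @ vs \<noteq> []" "set (us @ vs) \<subseteq> V" "v = pat us vs"
      using V[OF v(1)] by blast
    have le: "ideal_le w v" if w: "w \<in> set (us @ vs)" "w \<cdot> w \<noteq> w" for w
    proof -
      have "ideal_le v w"
        unfolding d(3) pat_def by (rule ideal_le_right[OF ideal_le_val[OF w(1)]])
      then have "ideal_le w z"
        using zmax[of w] w d(2) ideal_le_trans[OF v(4)] by blast
      then show ?thesis
        using v(4) by (rule ideal_le_trans)
    qed
    moreover obtain u where "u \<in> set (us @ vs)" "u \<cdot> u \<noteq> u"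
      using pat_idem[OF d(1)] v(2) d(3) by blast
    ultimately show ?thesis
      using d by blast
  qed
  have in_group: "\<exists>d. d \<cdot> d = d \<and> v \<in> max_subgroup d"
    if v: "v \<in> V" "ideal_le v z" "ideal_le z v" for v
  proof (cases "v \<cdot> v = v")
    case True
    then show ?thesis
      using idem_max_subgroup by blast
  next
    case False
    then obtain us vs u where "v = pat us vs" "u \<in> set (us @ vs)" "ideal_le u v"
      "\<And>w. w \<in> set (us @ vs) \<Longrightarrow> w \<cdot> w = w \<or> ideal_le w v"
      using decomp[OF v(1) _ v(2,3)] by blast
    then show ?thesis
      by (rule pat_in_max_subgroup) blast+
  qed
  obtain e where e: "e \<cdot> e = e" "z \<in> max_subgroup e"
    using in_group[OF z(1) ideal_le_refl ideal_le_refl] by blast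
  define G where "G = restricted f (max_subgroup e) e"
  interpret G: group G
    unfolding G_def by (rule group_max_subgroup[OF e(1)])
  have [simp]: "carrier G = max_subgroup e" "mult G = f" "one G = e"
    by (simp_all add: G_def restricted_def)
  have max_subgroup_le: "ideal_le v e" "ideal_le e v" if v: "v \<in> max_subgroup e" for v
  proof -
    obtain y where "e \<cdot> v = v" "v \<cdot> y = e"
      using v unfolding max_subgroup_def by blast
    then show "ideal_le v e" "ideal_le e v"
      using ideal_le_right[OF ideal_le_refl, of e v] ideal_le_right[OF ideal_le_refl, of v y] by simp_all
  qed
  \<comment> \<open>Induction along the derived series: once the elements of \<open>V\<close> in the
    subgroup lie in one term, the pattern pushes them into the next.\<close>
  have derived: "V \<inter> max_subgroup e \<subseteq> (derived G ^^ k) (max_subgroup e)" for k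
  proof (induction k)
    case (Suc k)
    let ?H = "(derived G ^^ k) (max_subgroup e)"
    have H: "subgroup ?H G"
      using G.exp_of_derived_is_subgroup[OF G.subgroup_self, of k] by simp
    have eH: "e \<in> ?H"
      using subgroup.one_closed[OF H] by simp
    have "v \<in> derived G ?H" if v: "v \<in> V" "v \<in> max_subgroup e" for v
    proof (cases "v \<cdot> v = v")
      case True
      then show ?thesis
        using idem_in_max_subgroup[OF v(2)] subgroup.one_closed[OF G.derived_is_subgroup[of ?H]]
          subgroup.subset[OF H] by simp
    next
      case False
      have vz: "ideal_le v z" "ideal_le z v"
        using max_subgroup_le[OF v(2)] max_subgroup_le[OF e(2)] ideal_le_trans by blast+
      obtain us vs u where d: "us @ vs \<noteq> []" "set (us @ vs) \<subseteq> V" "v = pat us vs"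
        "u \<in> set (us @ vs)" "ideal_le u v"
        "\<And>w. w \<in> set (us @ vs) \<Longrightarrow> w \<cdot> w = w \<or> ideal_le w v"
        using decomp[OF v(1) False vz] by blast
      obtain e' where e': "e' \<cdot> e' = e'" "v \<in> max_subgroup e'" "moves e' (us @ vs) e'"
        using pat_in_max_subgroup[OF d(3-6)] by blast
      \<comment> \<open>The identity of any maximal subgroup containing \<open>v\<close> is the only
        point in the domain of \<open>v\<close>.\<close>
      have "e = e'"
        using move_rank_one_unique[OF move_max_subgroup[OF v(2) e(1)] max_subgroup_le(1)[OF v(2)]
            move_max_subgroup[OF e'(2,1)]] e'(2) ideal_le_right[OF ideal_le_refl, of e' v]
        by (simp add: max_subgroup_def)
      with e' have mv: "moves e (us @ vs) e"
        by simp
      have ws: "w \<cdot> w = w \<or> ideal_le w v \<and> (\<exists>d. d \<cdot> d = d \<and> w \<in> max_subgroup d)"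
        if w: "w \<in> set (us @ vs)" for w
      proof (cases "w \<cdot> w = w")
        case False
        then have "ideal_le w v"
          using d(6)[OF w] by simp
        moreover have "ideal_le v w"
          unfolding d(3) pat_def by (rule ideal_le_right[OF ideal_le_val[OF w]])
        ultimately show ?thesis
          using in_group[of w] w d(2) vz ideal_le_trans by blast
      qed simp
      have fixed: "e \<cdot> w = w \<cdot> e" "w \<cdot> e = e \<or> w \<cdot> e = w \<and> w \<in> max_subgroup e"
        if w: "w \<in> set (us @ vs)" for w
        using moves_max_subgroup_fixed[OF mv max_subgroup_le(1)[OF v(2)] ws w] by blast+
      have "v = v \<cdot> e"
        using v(2) by (simp add: max_subgroup_def)
      \<comment> \<open>Multiplying all letters by the commuting idempotent \<open>e\<close> keeps
        the value \<open>v\<close> and turns each letter into \<open>e\<close> or an element of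
        \<open>V\<close> in the subgroup, to which the induction hypothesis applies.\<close>
      also have "\<dots> = pat (map (\<lambda>w. w \<cdot> e) us) (map (\<lambda>w. w \<cdot> e) vs)"
        unfolding d(3) by (rule pat_mult_commuting[OF d(1) e(1) fixed(1), symmetric])
      also have "\<dots> \<in> derived G ?H"
        unfolding G_def
      proof (rule pat_derived[OF e(1) H[unfolded G_def]])
        have "w \<cdot> e \<in> ?H" if w: "w \<in> set (us @ vs)" for w
          using fixed(2)[OF w] eH Suc d(2) w by auto
        then show "set (map (\<lambda>w. w \<cdot> e) us @ map (\<lambda>w. w \<cdot> e) vs)
            \<subseteq> (derived (restricted f (max_subgroup e) e) ^^ k) (max_subgroup e)"
          unfolding G_def by auto
      qed (use d(1) in simp)
      finally show ?thesis .
    qed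
    then show ?case
      by auto
  qed simp
  have "solvable G"
    using solv G.is_group unfolding all_subgroups_solvable_def G_def by blast
  then obtain k where "(derived G ^^ k) (max_subgroup e) = {e}"
    using G.solvable_imp_trivial_derived_seq[of "carrier G"] by (auto simp: solvable_def)
  then have "z = e"
    using derived[of k] z(1) e(2) by auto
  then show False
    using z(2) e(1) by simp
qed

section \<open>The chain of value sets\<close>

text \<open>Halves of any lengths are allowed, so one chain covers the words for every
  \<open>n\<close> and the height found below is independent of \<open>n\<close>. Height 0 stands
  for single variables.\<close>

primrec vals :: "nat \<Rightarrow> 'a set" where
  "vals 0 = UNIV"
| "vals (Suc k) = {pat us vs | us vs. us @ vs \<noteq> [] \<and> set (us @ vs) \<subseteq> vals k}"

declare vals.simps(2) [simp del]

lemma vals_Suc_subset: "vals (Suc k) \<subseteq> vals k"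
proof (induction k)
  case (Suc k)
  show ?case
  proof
    fix x assume "x \<in> vals (Suc (Suc k))"
    then obtain us vs where "us @ vs \<noteq> []" "set (us @ vs) \<subseteq> vals (Suc k)" "x = pat us vs"
      unfolding vals.simps(2)[of "Suc k"] by blast
    then show "x \<in> vals (Suc k)"
      using Suc unfolding vals.simps(2)[of k] by blast
  qed
qed simp

lemma vals_idem:
  assumes "all_subgroups_solvable f"
  obtains k where "\<And>x. x \<in> vals (Suc k) \<Longrightarrow> x \<cdot> x = x"
proof -
  \<comment> \<open>A member of least cardinality: as the chain decreases, it equals its successor,
    which is therefore reproduced by the pattern.\<close>
  obtain k where k: "\<And>l. card (vals k) \<le> card (vals l)"
    using ex_has_least_nat[of "\<lambda>_. True" _ "\<lambda>k. card (vals k)"] by blast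
  then have eq: "vals (Suc k) = vals k"
    using vals_Suc_subset by (intro card_seteq) simp_all
  have "x \<cdot> x = x" if "x \<in> vals (Suc k)" for x
  proof (rule closed_set_idem[OF _ assms that])
    fix v assume "v \<in> vals (Suc k)"
    then show "\<exists>us vs. us @ vs \<noteq> [] \<and> set (us @ vs) \<subseteq> vals (Suc k) \<and> v = pat us vs"
      by (subst (asm) vals.simps(2), unfold eq) blast
  qed
  then show thesis
    by (rule that)
qed

section \<open>Evaluation of the words\<close>

lemma val_map_word_power:
  assumes "w \<noteq> []" "0 < k"
  shows "val (map \<phi> (word_power w k)) = pow (val (map \<phi> w)) k"
  using assms by (simp add: word_power_def map_concat val_concat pow_def)

lemma val_map_concat:
  assumes "js \<noteq> []" "\<And>j. w j \<noteq> []"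
  shows "val (map \<phi> (concat (map w js))) = val (map (\<lambda>j. val (map \<phi> (w j))) js)"
  using assms by (simp add: map_concat val_concat comp_def image_iff)

lemma val_v_pattern:
  fixes w :: "nat \<Rightarrow> 'v list"
  assumes n: "0 < n" and w: "\<And>j. w j \<noteq> []"
  shows "val (map \<phi> (v_pattern n m w))
    = pat (map (\<lambda>j. val (map \<phi> (w j))) [1..<n + 1]) (map (\<lambda>j. val (map \<phi> (w j))) [n + 1..<2 * n + 1])"
    and "v_pattern n m w \<noteq> []"
proof -
  let ?us = "[1..<n + 1]" and ?vs = "[n + 1..<2 * n + 1]"
  let ?x = "\<lambda>j. val (map \<phi> (w j))"
  have split: "[1..<2 * n + 1] = ?us @ ?vs"
  proof -
    have "2 * n + 1 = n + 1 + n"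
      by simp
    then show ?thesis
      by (simp only:) (rule upt_add_eq_append, simp)
  qed
  have m1: "0 < 2 * m - 1"
    using exponent_pos by simp
  have ne: "concat (map w js) \<noteq> []" if "js \<noteq> []" for js
    using that w by (cases js) auto
  define a where "a = concat (map w (?us @ ?vs))"
  define b where "b = concat (map w (rev ?us @ ?vs))"
  have ne': "?us @ ?vs \<noteq> []" "rev ?us @ ?vs \<noteq> []"
    using n by auto
  have a: "a \<noteq> []" and b: "b \<noteq> []"
    unfolding a_def b_def by (rule ne[OF ne'(1)], rule ne[OF ne'(2)])
  have eq: "v_pattern n m w = a @ word_power b (2 * m - 1)"
    unfolding v_pattern_def split a_def b_def by simp
  show "v_pattern n m w \<noteq> []"
    using a eq by simp
  have "word_power b (2 * m - 1) \<noteq> []"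
    using b m1 unfolding word_power_def by (cases "2 * m - 1") simp_all
  then have "val (map \<phi> (v_pattern n m w)) = val (map \<phi> a) \<cdot> pow (val (map \<phi> b)) (2 * m - 1)"
    unfolding eq map_append
    by (subst val_append) (simp_all only: a b map_is_Nil_conv val_map_word_power[OF b m1] not_False_eq_True)
  also have "val (map \<phi> a) = val (map ?x (?us @ ?vs))"
    unfolding a_def by (rule val_map_concat[OF ne'(1) w])
  also have "val (map \<phi> b) = val (map ?x (rev ?us @ ?vs))"
    unfolding b_def by (rule val_map_concat[OF ne'(2) w])
  finally show "val (map \<phi> (v_pattern n m w)) = pat (map ?x ?us) (map ?x ?vs)"
    unfolding pat_def map_append rev_map .
qed

lemma val_v_word:
  assumes n: "0 < n"
  shows "v_word n m (Suc h) \<noteq> []" "val (map \<phi> (v_word n m (Suc h))) \<in> vals (Suc h)"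
proof -
  have pat_vals: "pat (map y [1..<n + 1]) (map y [n + 1..<2 * n + 1]) \<in> vals (Suc k)"
    if "\<And>j. y j \<in> vals k" for y :: "nat \<Rightarrow> 'a" and k
  proof -
    have "map y [1..<n + 1] @ map y [n + 1..<2 * n + 1] \<noteq> []"
      using n by simp
    moreover have "set (map y [1..<n + 1] @ map y [n + 1..<2 * n + 1]) \<subseteq> vals k"
      using that by auto
    ultimately show ?thesis
      unfolding vals.simps(2) by blast
  qed
  have "v_word n m (Suc h) \<noteq> [] \<and> (\<forall>\<phi>. val (map \<phi> (v_word n m (Suc h))) \<in> vals (Suc h))"
  proof (induction h)
    case 0
    show ?case
      using val_v_pattern[OF n, of "\<lambda>j. [[j]]"] pat_vals[of "\<lambda>j. \<phi> [j]" 0 for \<phi>] by simp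
  next
    case (Suc h)
    \<comment> \<open>Renaming \<open>i\<close> to \<open>i @ [j]\<close> before applying
      \<open>\<phi>\<close> is again an assignment, so the induction hypothesis, stated for all
      assignments, covers every copy.\<close>
    have "pat (map (\<lambda>j. val (map \<phi> (map (\<lambda>i. i @ [j]) (v_word n m (Suc h))))) [1..<n + 1])
        (map (\<lambda>j. val (map \<phi> (map (\<lambda>i. i @ [j]) (v_word n m (Suc h))))) [n + 1..<2 * n + 1])
        \<in> vals (Suc (Suc h))" for \<phi>
      by (rule pat_vals) (unfold map_map, use Suc in blast)
    then show ?case
      using val_v_pattern[OF n, of "\<lambda>j. map (\<lambda>i. i @ [j]) (v_word n m (Suc h))"] Suc
      by (simp only: v_word.simps(3) map_is_Nil_conv simp_thms)
  qed
  then show "v_word n m (Suc h) \<noteq> []" "val (map \<phi> (v_word n m (Suc h))) \<in> vals (Suc h)"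
    by blast+
qed

lemma v_word_satisfies:
  assumes "\<And>x. x \<in> vals (Suc h) \<Longrightarrow> x \<cdot> x = x" "0 < n"
  shows "satisfies_identity f (v_word n m (Suc h)) (word_power (v_word n m (Suc h)) 2)"
proof -
  let ?w = "v_word n m (Suc h)"
  have ne: "?w \<noteq> []" and vals: "\<And>\<phi>. val (map \<phi> ?w) \<in> vals (Suc h)"
    using val_v_word[OF assms(2)] by blast+
  have "word_power ?w 2 = ?w @ ?w"
    by (simp add: word_power_def numeral_2_eq_2)
  then show ?thesis
    unfolding satisfies_identity_def
    using ne assms(1)[OF vals] by (simp add: word_value_eq_val_map val_append del: v_word.simps)
qed

end

section \<open>Choice of the exponent and conclusion\<close>

lemma (in finite_block_group) ex_exponent: "\<exists>m. block_group_exponent f m"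
proof -
  obtain N where N: "2 \<le> N" "\<And>x. pow x N \<cdot> pow x N = pow x N"
    using ex_uniform_idem_pow by blast
  have N2: "pow x (2 * N) = pow x N" for x
    using pow_add[of N N x] N by (simp add: mult_2)
  have "pow x (2 * N - 1) \<cdot> pow x N = pow x (2 * N - 1)" for x
  proof -
    \<comment> \<open>The summand \<open>N - 1\<close> is positive because \<open>N \<ge> 2\<close>,
      so the idempotent \<open>pow x N\<close> splits off on the right.\<close>
    have "2 * N - 1 = (N - 1) + N"
      using N(1) by simp
    then have "pow x (2 * N - 1) = pow x (N - 1) \<cdot> pow x N"
      using pow_add[of "N - 1" N x] N(1) by simp
    then show ?thesis
      by (simp add: assoc N(2))
  qed
  then have "block_group_exponent f N"
    using N by unfold_locales (simp_all add: N2)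
  then show ?thesis ..
qed

theorem proposition3p9:
  fixes f :: "'a::finite \<Rightarrow> 'a \<Rightarrow> 'a"
  assumes "block_group f"
    and "all_subgroups_solvable f"
  shows "\<exists>q r :: nat. q > 0 \<and> r > 0 \<and>
    (\<forall>n\<ge>2. satisfies_identity f (v_word n q r) (word_power (v_word n q r) 2))"
proof -
  interpret finite_block_group f
    by (rule finite_block_group.intro[OF assms(1)])
  obtain q where "block_group_exponent f q"
    using ex_exponent by blast
  then interpret block_group_exponent f q .
  obtain h where "\<And>x. x \<in> vals (Suc h) \<Longrightarrow> f x x = x"
    using vals_idem[OF assms(2)] by blast
  then have "\<forall>n\<ge>2. satisfies_identity f (v_word n q (Suc h)) (word_power (v_word n q (Suc h)) 2)"
    using v_word_satisfies by simp
  then show ?thesis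
    using exponent_pos by blast
qed

end
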